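(* Assume that the translates $\{\varphi(\cdot-k)\}_{k\in\Gamma}$ are linearly independent. Let $\lambda\in\mathbb{C}$, $r\in\mathbb{N}$ ($r\geq1$), $n\geq 0$. (1) If $h\in\mathcal{S}(\varphi)$, $h=Y\Phi$ with $Y\in\ell(\Gamma)$, and $h\in\mathcal{H}(A,\lambda,r)$, then $Y\in\operatorname{Ker}(L-\lambda I)^r$ and $P_nY\in\operatorname{Ker}(T_n-\lambda I)^r$. (2) Conversely, assume that $\lambda\neq0$, that $v\in\operatorname{Ker}(T_n-\lambda I)^r$, and that $Y_v\in\ell(\Gamma)$ is the unique extension of $v$ (i.e. $P_nY_v=v$) such that $Y_v\in\operatorname{Ker}(L-\lambda I)^r$. Then the function $h=Y_v\Phi$ belongs to $\mathcal{H}(A,\lambda,r)$. Here $L$ and $T_n$ act on row vectors by right multiplication ($Y\mapsto YL$, $v\mapsto vT_n$), and kernels refer to this action.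
   Context: $\Gamma\subset\mathbb{R}^d$ is a lattice (the image of $\mathbb{Z}^d$ under a nonsingular linear map) and $A$ is a dilation matrix associated to $\Gamma$: a $d\times d$ real matrix with $A(\Gamma)\subset\Gamma$ all of whose eigenvalues have modulus $>1$. $\Lambda\subset\Gamma$ is finite and nonempty, $c_k\in\mathbb{C}$ for $k\in\Lambda$, $c_k=0$ for $k\in\Gamma\setminus\Lambda$. $\varphi:\mathbb{R}^d\to\mathbb{C}$ is a compactly supported function satisfying $\varphi(x)=\sum_{k\in\Lambda}c_k\varphi(Ax-k)$ for $x\in\mathbb{R}^d$. $\ell(\Gamma)$ is the space of all complex sequences $Y=\{y_k\}_{k\in\Gamma}$ (row vectors). $\Phi(x)=\{\varphi(x+k)\}_{k\in\Gamma}$ is an infinite column vector, and $Y\Phi(x)=\sum_{k\in\Gamma}y_k\varphi(x+k)$. $\mathcal{S}(\varphi)=\{Y\Phi: Y\in\ell(\Gamma)\}$. The translates are linearly independent if $\sum_{k\in\Gamma}\alpha_k\varphi(\cdot-k)\equiv0$ with $\{\alpha_k\}\in\ell(\Gamma)$ implies all $\alpha_k=0$. $L=[c_{Ai-j}]_{i,j\in\Gamma}$; $(YL)_j=\sum_iy_ic_{Ai-j}$ (finite sum for each $j$). A function $h:\mathbb{R}^d\to\mathbb{C}$ is in the class $\mathcal{H}(A,\lambda,r)$ if $\sum_{k=0}^r\binom{r}{k}(-\lambda)^kh(A^{k-r}x)=0$ for every $x\in\mathbb{R}^d$; equivalently $(D_A-\lambda I)^rh=0$ with $(D_Af)(x)=f(A^{-1}x)$.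 For a finite nonempty $H\subset\Gamma$ and $B\subset\mathbb{R}^d$ let $w_H(B)=A^{-1}(B+H)$; $K_H$ is the unique nonempty compact set with $w_H(K_H)=K_H$, and $\Omega_H=K_H\cap\Gamma$. A set $\Omega\subset\Gamma$ is $H$-admissible if $w_H(\Omega)\cap\Gamma\subset\Omega$. $D\subset\Gamma$ is a full set of representatives of $\Gamma/A(\Gamma)$ with $0\in D$, such that the translates $K_D+k$, $k\in\Gamma$, of $Q=K_D$ cover $\mathbb{R}^d$ with overlaps of measure zero. $\Lambda'=\Lambda-D$ and $\Omega'=K_{\Lambda'}\cap\Gamma$. $\{\Omega_n\}_{n\ge0}$ is a fixed sequence of finite subsets of $\Gamma$ such that: $\Omega_0=\Omega_\Lambda$; $\Omega_i\subsetneq\Omega_{i+1}$ for all $i\ge 0$ and $\bigcup_i\Omega_i=\Gamma$; each $\Omega_i$ is $\Lambda$-admissible and $w_\Lambda(\Omega_{i+1})\cap\Gamma\subset\Omega_i$ for all $i\ge 0$; $\Omega_{n_0}=\Omega'$ for some index $n_0$; and for $i\ge n_0$, $\Omega_i$ is $\Lambda'$-admissible and $w_{\Lambda'}(\Omega_{i+1})\cap\Gamma\subset\Omega_i$. $T_n=[c_{Ai-j}]_{i,j\in\Omega_n}$, and $P_n:\ell(\Gamma)\to\mathbb{C}^{1\times\Omega_n}$ is the restriction $P_nY=\{y_k\}_{k\in\Omega_n}$. For $\lambda\ne0$, every $v\in\operatorname{Ker}(T_n-\lambda I)^r$ has exactly one extension $Y_v\in\operatorname{Ker}(L-\lambda I)^r$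 with $P_nY_v=v$. *)

theory Defs
  imports "HOL-Analysis.Analysis"
begin

definition lattice_of :: "real^'d^'d \<Rightarrow> (real^'d) set" where
  "lattice_of B = range (\<lambda>z :: int^'d. B *v (\<chi> i. real_of_int (z $ i)))"

definition is_lattice :: "(real^'d) set \<Rightarrow> bool" where
  "is_lattice \<Gamma> \<longleftrightarrow> (\<exists>B :: real^'d^'d. invertible B \<and> \<Gamma> = lattice_of B)"

text \<open>Eigenvalues of a real matrix are taken over the complex numbers.\<close>

definition complex_eigenvalue :: "real^'d^'d \<Rightarrow> complex \<Rightarrow> bool" where
  "complex_eigenvalue A \<mu> \<longleftrightarrow>
     (\<exists>v :: complex^'d. v \<noteq> 0 \<and> (\<chi> i j. complex_of_real (A $ i $ j)) *v v = \<mu> *s v)"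

definition dilation_matrix :: "(real^'d) set \<Rightarrow> real^'d^'d \<Rightarrow> bool" where
  "dilation_matrix \<Gamma> A \<longleftrightarrow>
     (*v) A ` \<Gamma> \<subseteq> \<Gamma> \<and> (\<forall>\<mu>. complex_eigenvalue A \<mu> \<longrightarrow> cmod \<mu> > 1)"

definition compactly_supported :: "(real^'d \<Rightarrow> complex) \<Rightarrow> bool" where
  "compactly_supported f \<longleftrightarrow> compact (closure {x. f x \<noteq> 0})"

text \<open>Sequences indexed by a set \<open>S\<close> are encoded as total functions vanishing off \<open>S\<close>, so that
  equality of sequences is equality of functions. With \<open>S = \<Gamma>\<close> this is the space of all
  complex sequences on \<open>\<Gamma>\<close>, and with \<open>S\<close> finite the space of row vectors indexed by \<open>S\<close>.\<close>

definition seqs :: "(real^'d) set \<Rightarrow> (real^'d \<Rightarrow> complex) set" where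
  "seqs S = {Y. \<forall>k. k \<notin> S \<longrightarrow> Y k = 0}"

definition restr :: "(real^'d) set \<Rightarrow> (real^'d \<Rightarrow> complex) \<Rightarrow> (real^'d \<Rightarrow> complex)" where
  "restr S Y = (\<lambda>k. if k \<in> S then Y k else 0)"

text \<open>The function \<open>Y\<Phi>\<close>. For compactly supported \<open>\<phi>\<close> and a lattice \<open>\<Gamma>\<close> only finitely many
  terms are nonzero at each point, so the infinite sum is a finite one.\<close>

definition combine :: "(real^'d) set \<Rightarrow> (real^'d \<Rightarrow> complex) \<Rightarrow> (real^'d \<Rightarrow> complex) \<Rightarrow> real^'d \<Rightarrow> complex" where
  "combine \<Gamma> \<phi> Y = (\<lambda>x. \<Sum>\<^sub>\<infinity>k\<in>\<Gamma>. Y k * \<phi> (x + k))"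

definition translate_space :: "(real^'d) set \<Rightarrow> (real^'d \<Rightarrow> complex) \<Rightarrow> (real^'d \<Rightarrow> complex) set" where
  "translate_space \<Gamma> \<phi> = combine \<Gamma> \<phi> ` seqs \<Gamma>"

definition lin_indep_translates :: "(real^'d) set \<Rightarrow> (real^'d \<Rightarrow> complex) \<Rightarrow> bool" where
  "lin_indep_translates \<Gamma> \<phi> \<longleftrightarrow>
     (\<forall>\<alpha>\<in>seqs \<Gamma>. (\<forall>x. (\<Sum>\<^sub>\<infinity>k\<in>\<Gamma>. \<alpha> k * \<phi> (x - k)) = 0) \<longrightarrow> (\<forall>k\<in>\<Gamma>. \<alpha> k = 0))"

text \<open>The action \<open>Y \<mapsto> YM\<close> on row vectors of the matrix \<open>M = [c (A i - j)]\<close> with \<open>i, j\<close>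
  ranging over \<open>S\<close>. For \<open>S = \<Gamma>\<close> the matrix is \<open>L\<close>, for \<open>S = \<Omega> n\<close> it is \<open>T n\<close>. When \<open>c\<close> has finite
  support on the lattice \<open>\<Gamma>\<close>, every entry of \<open>YL\<close> is a finite sum.\<close>

definition row_act ::
  "real^'d^'d \<Rightarrow> (real^'d \<Rightarrow> complex) \<Rightarrow> (real^'d) set \<Rightarrow> (real^'d \<Rightarrow> complex) \<Rightarrow> (real^'d \<Rightarrow> complex)" where
  "row_act A c S Y = (\<lambda>j. if j \<in> S then (\<Sum>\<^sub>\<infinity>i\<in>S. Y i * c (A *v i - j)) else 0)"

text \<open>The kernel of the \<open>r\<close>-th power of \<open>M - lam I\<close>, for the same action on row vectors.\<close>

definition ker_pow ::
  "real^'d^'d \<Rightarrow> (real^'d \<Rightarrow> complex) \<Rightarrow> (real^'d) set \<Rightarrow> complex \<Rightarrow> nat \<Rightarrow> (real^'d \<Rightarrow> complex) set" where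
  "ker_pow A c S lam r =
     {Y \<in> seqs S. ((\<lambda>Z j. row_act A c S Z j - lam * Z j) ^^ r) Y = (\<lambda>_. 0)}"

text \<open>The exponent \<open>k - r\<close> of \<open>A\<close> is nonpositive, so \<open>A\<close> to this power is the \<open>(r - k)\<close>-fold iterate
  of the inverse of \<open>A\<close>.\<close>

definition H_class :: "real^'d^'d \<Rightarrow> complex \<Rightarrow> nat \<Rightarrow> (real^'d \<Rightarrow> complex) set" where
  "H_class A lam r =
     {h. \<forall>x. (\<Sum>k=0..r. of_nat (r choose k) * (- lam) ^ k * h (((*v) (matrix_inv A) ^^ (r - k)) x)) = 0}"

definition w_map :: "real^'d^'d \<Rightarrow> (real^'d) set \<Rightarrow> (real^'d) set \<Rightarrow> (real^'d) set" where
  "w_map A H B = {matrix_inv A *v (b + k) | b k. b \<in> B \<and> k \<in> H}"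

definition attractor :: "real^'d^'d \<Rightarrow> (real^'d) set \<Rightarrow> (real^'d) set" where
  "attractor A H = (THE K. K \<noteq> {} \<and> compact K \<and> w_map A H K = K)"

definition admissible :: "(real^'d) set \<Rightarrow> real^'d^'d \<Rightarrow> (real^'d) set \<Rightarrow> (real^'d) set \<Rightarrow> bool" where
  "admissible \<Gamma> A H S \<longleftrightarrow> S \<subseteq> \<Gamma> \<and> w_map A H S \<inter> \<Gamma> \<subseteq> S"

definition full_representatives :: "(real^'d) set \<Rightarrow> real^'d^'d \<Rightarrow> (real^'d) set \<Rightarrow> bool" where
  "full_representatives \<Gamma> A D \<longleftrightarrow>
     D \<subseteq> \<Gamma> \<and> (\<forall>k\<in>\<Gamma>. \<exists>!d. d \<in> D \<and> k - d \<in> (*v) A ` \<Gamma>)"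

definition tiles :: "(real^'d) set \<Rightarrow> (real^'d) set \<Rightarrow> bool" where
  "tiles \<Gamma> Q \<longleftrightarrow>
     (\<Union>k\<in>\<Gamma>. (+) k ` Q) = UNIV \<and>
     (\<forall>k\<in>\<Gamma>. \<forall>l\<in>\<Gamma>. k \<noteq> l \<longrightarrow> negligible ((+) k ` Q \<inter> (+) l ` Q))"

definition diff_set :: "(real^'d) set \<Rightarrow> (real^'d) set \<Rightarrow> (real^'d) set" where
  "diff_set X D = {a - d | a d. a \<in> X \<and> d \<in> D}"

definition admissible_chain ::
  "(real^'d) set \<Rightarrow> real^'d^'d \<Rightarrow> (real^'d) set \<Rightarrow> (real^'d) set \<Rightarrow> (nat \<Rightarrow> (real^'d) set) \<Rightarrow> bool" where
  "admissible_chain \<Gamma> A \<Lambda> \<Lambda>' \<Omega> \<longleftrightarrow>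
     (\<forall>i. finite (\<Omega> i) \<and> \<Omega> i \<subseteq> \<Gamma>) \<and>
     \<Omega> 0 = attractor A \<Lambda> \<inter> \<Gamma> \<and>
     (\<forall>i. \<Omega> i \<subset> \<Omega> (Suc i)) \<and>
     (\<Union>i. \<Omega> i) = \<Gamma> \<and>
     (\<forall>i. admissible \<Gamma> A \<Lambda> (\<Omega> i) \<and> w_map A \<Lambda> (\<Omega> (Suc i)) \<inter> \<Gamma> \<subseteq> \<Omega> i) \<and>
     (\<exists>n0. \<Omega> n0 = attractor A \<Lambda>' \<inter> \<Gamma> \<and>
        (\<forall>i\<ge>n0. admissible \<Gamma> A \<Lambda>' (\<Omega> i) \<and> w_map A \<Lambda>' (\<Omega> (Suc i)) \<inter> \<Gamma> \<subseteq> \<Omega> i))"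

end

theory Submission
  imports Defs
begin

text \<open>
  Substituting the refinement equation into each translate gives \<open>\<Phi>(x) = L \<Phi>(A x)\<close>, hence
  \<open>(Y\<Phi>)(A\<^sup>-\<^sup>1 x) = ((YL)\<Phi>)(x)\<close>: under the map \<open>Y \<mapsto> Y\<Phi>\<close> the dilation operator
  \<open>D\<^sub>A\<close> corresponds to right multiplication by \<open>L\<close> (lemma \<open>combine_inverse_dilation\<close>). Therefore
  \<open>(D\<^sub>A - \<lambda>)\<^sup>r (Y\<Phi>) = (Y (L - \<lambda>)\<^sup>r)\<Phi>\<close>, and by the binomial theorem the left-hand side
  vanishes exactly when \<open>Y\<Phi>\<close> lies in the class \<open>H(A, \<lambda>, r)\<close>. So \<open>Y \<in> Ker (L - \<lambda>)\<^sup>r\<close> puts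
  \<open>Y\<Phi>\<close> in the class, and linear independence, that is injectivity of \<open>Y \<mapsto> Y\<Phi>\<close>, gives the
  converse.

  The finite sections are handled by admissibility of \<open>\<Omega>\<close>: an entry \<open>c (A i - j)\<close> with
  \<open>j \<in> \<Omega>\<close> can be nonzero only for \<open>i \<in> \<Omega>\<close>, so restriction to \<open>\<Omega>\<close> intertwines \<open>L\<close> with the
  finite matrix on \<open>\<Omega>\<close> (lemma \<open>restr_row_act\<close>) and carries one kernel into the other.

  All sums over the lattice are finite sums, because a lattice meets every bounded set in a
  finite set, the mask \<open>c\<close> has finite support on it, and a dilation matrix is injective.
\<close>

section \<open>Lattices and dilation matrices\<close>

lemma invertible_matrix_inv_vec:
  fixes A :: "real^'d^'d"
  assumes "invertible A"
  shows "matrix_inv A *v (A *v x) = x" "A *v (matrix_inv A *v x) = x"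
proof -
  have "A ** matrix_inv A = mat 1 \<and> matrix_inv A ** A = mat 1"
    unfolding matrix_inv_def by (rule someI_ex) (use assms in \<open>simp add: invertible_def\<close>)
  then show "matrix_inv A *v (A *v x) = x" "A *v (matrix_inv A *v x) = x"
    by (simp_all add: matrix_vector_mul_assoc)
qed

lemma lattice_diff:
  fixes \<Gamma> :: "(real^'d) set"
  assumes "is_lattice \<Gamma>" "x \<in> \<Gamma>" "y \<in> \<Gamma>"
  shows "x - y \<in> \<Gamma>"
proof -
  obtain B :: "real^'d^'d" where B: "\<Gamma> = lattice_of B"
    using assms(1) unfolding is_lattice_def by blast
  obtain u v :: "int^'d" where
    "x = B *v (\<chi> i. real_of_int (u $ i))" "y = B *v (\<chi> i. real_of_int (v $ i))"
    using assms(2,3) unfolding B lattice_of_def by blast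
  then have "x - y = B *v ((\<chi> i. real_of_int (u $ i)) - (\<chi> i. real_of_int (v $ i)))"
    by (simp add: matrix_vector_mult_diff_distrib)
  also have "(\<chi> i. real_of_int (u $ i)) - (\<chi> i. real_of_int (v $ i))
      = ((\<chi> i. real_of_int ((u - v) $ i)) :: real^'d)"
    by (simp add: vec_eq_iff)
  finally show ?thesis
    unfolding B lattice_of_def by blast
qed

lemma lattice_uminus:
  assumes "is_lattice \<Gamma>" "x \<in> \<Gamma>"
  shows "- x \<in> \<Gamma>"
proof -
  have "x - x \<in> \<Gamma>" using lattice_diff[OF assms assms(2)] .
  then have "(x - x) - x \<in> \<Gamma>" by (rule lattice_diff[OF assms(1) _ assms(2)])
  then show ?thesis by simp
qed

lemma finite_bounded_int_vectors: "finite {z :: int^'d. \<forall>i. \<bar>z $ i\<bar> \<le> N}"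
proof (rule finite_subset)
  show "{z :: int^'d. \<forall>i. \<bar>z $ i\<bar> \<le> N} \<subseteq> vec_lambda ` (UNIV \<rightarrow>\<^sub>E {- N..N})"
  proof
    fix z :: "int^'d" assume "z \<in> {z. \<forall>i. \<bar>z $ i\<bar> \<le> N}"
    then have "vec_nth z \<in> UNIV \<rightarrow>\<^sub>E {- N..N}" by (auto simp: abs_le_iff minus_le_iff)
    then show "z \<in> vec_lambda ` (UNIV \<rightarrow>\<^sub>E {- N..N})"
      by (metis imageI vec_nth_inverse)
  qed
  show "finite (vec_lambda ` ((UNIV :: 'd set) \<rightarrow>\<^sub>E {- N..N}))"
    by (intro finite_imageI finite_PiE) auto
qed

text \<open>The inverse of the lattice basis is a bounded operator, so the integer coordinates of the
  lattice points in a bounded set are bounded.\<close>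

lemma finite_lattice_Int_bounded:
  fixes \<Gamma> :: "(real^'d) set"
  assumes "is_lattice \<Gamma>" "bounded S"
  shows "finite (\<Gamma> \<inter> S)"
proof -
  obtain B :: "real^'d^'d" where "invertible B" and \<Gamma>: "\<Gamma> = lattice_of B"
    using assms(1) unfolding is_lattice_def by blast
  have "bounded ((*v) (matrix_inv B) ` S)"
    by (rule bounded_linear_image[OF assms(2)]) simp
  then obtain M where M: "norm (matrix_inv B *v x) \<le> M" if "x \<in> S" for x
    unfolding bounded_iff by auto
  have "\<Gamma> \<inter> S \<subseteq> (\<lambda>z. B *v (\<chi> i. real_of_int (z $ i))) ` {z. \<forall>i. \<bar>z $ i\<bar> \<le> \<lfloor>M\<rfloor>}"
  proof
    fix x assume x: "x \<in> \<Gamma> \<inter> S"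
    then obtain z :: "int^'d" where z: "x = B *v (\<chi> i. real_of_int (z $ i))"
      unfolding \<Gamma> lattice_of_def by blast
    have coords: "matrix_inv B *v x = (\<chi> i. real_of_int (z $ i))"
      unfolding z using \<open>invertible B\<close>
      by (simp add: invertible_matrix_inv_vec)
    have "\<bar>z $ i\<bar> \<le> \<lfloor>M\<rfloor>" for i
    proof -
      have "\<bar>real_of_int (z $ i)\<bar> \<le> norm (matrix_inv B *v x)"
        using component_le_norm_cart[of "matrix_inv B *v x" i] unfolding coords by simp
      also have "\<dots> \<le> M" using M x by blast
      finally show ?thesis by (simp add: le_floor_iff)
    qed
    then show "x \<in> (\<lambda>z. B *v (\<chi> i. real_of_int (z $ i))) ` {z. \<forall>i. \<bar>z $ i\<bar> \<le> \<lfloor>M\<rfloor>}"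
      using z by blast
  qed
  then show ?thesis
    by (rule finite_subset) (intro finite_imageI finite_bounded_int_vectors)
qed

lemma finite_lattice_support:
  assumes "is_lattice \<Gamma>" "compactly_supported \<phi>"
  shows "finite {k\<in>\<Gamma>. \<phi> (x + k) \<noteq> 0}"
proof -
  have "bounded {y. \<phi> y \<noteq> 0}"
    using assms(2) unfolding compactly_supported_def
    by (meson bounded_subset closure_subset compact_imp_bounded)
  then have "bounded ((+) (- x) ` {y. \<phi> y \<noteq> 0})"
    by (rule bounded_translation)
  then have "finite (\<Gamma> \<inter> (+) (- x) ` {y. \<phi> y \<noteq> 0})"
    by (rule finite_lattice_Int_bounded[OF assms(1)])
  moreover have "{k\<in>\<Gamma>. \<phi> (x + k) \<noteq> 0} \<subseteq> \<Gamma> \<inter> (+) (- x) ` {y. \<phi> y \<noteq> 0}"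
    by (force simp: image_iff)
  ultimately show ?thesis by (rule rev_finite_subset)
qed

text \<open>A nonzero real vector in the kernel would be a complex eigenvector for the eigenvalue
  \<open>0\<close>, whose modulus is not greater than \<open>1\<close>.\<close>

lemma dilation_matrix_invertible:
  fixes A :: "real^'d^'d"
  assumes "dilation_matrix \<Gamma> A"
  shows "invertible A"
proof -
  have "x = 0" if x: "A *v x = 0" for x
  proof (rule ccontr)
    assume "x \<noteq> 0"
    define v :: "complex^'d" where "v = (\<chi> i. complex_of_real (x $ i))"
    have "v \<noteq> 0" using \<open>x \<noteq> 0\<close> by (simp add: v_def vec_eq_iff)
    moreover have "(\<chi> i j. complex_of_real (A $ i $ j)) *v v = 0 *s v"
    proof -
      have "(\<Sum>j\<in>UNIV. complex_of_real (A $ i $ j) * complex_of_real (x $ j)) = 0" for i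
      proof -
        have "(\<Sum>j\<in>UNIV. complex_of_real (A $ i $ j) * complex_of_real (x $ j))
            = complex_of_real ((A *v x) $ i)"
          by (simp add: matrix_vector_mult_def)
        then show ?thesis by (simp add: x)
      qed
      then show ?thesis by (simp add: vec_eq_iff matrix_vector_mult_def v_def)
    qed
    ultimately have "complex_eigenvalue A 0" unfolding complex_eigenvalue_def by blast
    then show False using assms unfolding dilation_matrix_def by fastforce
  qed
  then show ?thesis
    using invertible_left_inverse matrix_left_invertible_ker by blast
qed

section \<open>Dilation acts on combinations of translates through \<open>L\<close>\<close>

lemma infsum_finite_support:
  fixes f :: "'a \<Rightarrow> complex"
  assumes "finite F" "F \<subseteq> S" "\<And>k. k \<in> S \<Longrightarrow> k \<notin> F \<Longrightarrow> f k = 0"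
  shows "(\<Sum>\<^sub>\<infinity>k\<in>S. f k) = (\<Sum>k\<in>F. f k)"
proof -
  have "(\<Sum>\<^sub>\<infinity>k\<in>S. f k) = (\<Sum>\<^sub>\<infinity>k\<in>F. f k)"
    using assms by (intro infsum_cong_neutral) auto
  then show ?thesis using assms(1) by simp
qed

lemma finite_column_support:
  fixes A :: "real^'d^'d"
  assumes "invertible A" "finite \<Lambda>" "\<forall>k\<in>\<Gamma> - \<Lambda>. c k = (0::complex)"
    and "\<And>i. i \<in> \<Gamma> \<Longrightarrow> A *v i - j \<in> \<Gamma>"
  shows "finite {i\<in>\<Gamma>. c (A *v i - j) \<noteq> 0}"
proof -
  have "{i\<in>\<Gamma>. c (A *v i - j) \<noteq> 0} \<subseteq> (\<lambda>k. matrix_inv A *v (k + j)) ` \<Lambda>"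
  proof
    fix i assume i: "i \<in> {i\<in>\<Gamma>. c (A *v i - j) \<noteq> 0}"
    then have "A *v i - j \<in> \<Lambda>" using assms(3,4) by blast
    moreover have "i = matrix_inv A *v ((A *v i - j) + j)"
      using assms(1) by (simp add: invertible_matrix_inv_vec)
    ultimately show "i \<in> (\<lambda>k. matrix_inv A *v (k + j)) ` \<Lambda>" by blast
  qed
  then show ?thesis by (rule finite_subset) (simp add: assms(2))
qed

lemma combine_diff_scale:
  assumes "is_lattice \<Gamma>" "compactly_supported \<phi>"
  shows "combine \<Gamma> \<phi> (\<lambda>j. Y j - a * Z j) x = combine \<Gamma> \<phi> Y x - a * combine \<Gamma> \<phi> Z x"
proof -
  let ?F = "{k\<in>\<Gamma>. \<phi> (x + k) \<noteq> 0}"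
  have "combine \<Gamma> \<phi> W x = (\<Sum>k\<in>?F. W k * \<phi> (x + k))" for W
    unfolding combine_def
    by (rule infsum_finite_support) (use finite_lattice_support[OF assms] in auto)
  then show ?thesis
    by (simp add: sum_subtractf sum_distrib_left algebra_simps)
qed

text \<open>This is the identity \<open>\<Phi>(x) = L \<Phi>(A x)\<close>, multiplied by \<open>Y\<close>. Only the finitely many
  \<open>j\<close> with \<open>\<phi> (A x + j) \<noteq> 0\<close> and, for each of them, the finitely many \<open>i\<close> with
  \<open>c (A i - j) \<noteq> 0\<close> contribute, which justifies exchanging the two sums.\<close>

lemma combine_dilation:
  fixes A :: "real^'d^'d"
  assumes lat: "is_lattice \<Gamma>" and dil: "dilation_matrix \<Gamma> A"
    and "\<Lambda> \<subseteq> \<Gamma>" and "finite \<Lambda>" and c: "\<forall>k\<in>\<Gamma> - \<Lambda>. c k = 0"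
    and supp: "compactly_supported \<phi>"
    and refine: "\<forall>x. \<phi> x = (\<Sum>k\<in>\<Lambda>. c k * \<phi> (A *v x - k))"
  shows "combine \<Gamma> \<phi> (row_act A c \<Gamma> Y) (A *v x) = combine \<Gamma> \<phi> Y x"
proof -
  define J where "J = {j\<in>\<Gamma>. \<phi> (A *v x + j) \<noteq> 0}"
  define I where "I = (\<Union>j\<in>J. {i\<in>\<Gamma>. c (A *v i - j) \<noteq> 0})"
  have "finite J" unfolding J_def by (rule finite_lattice_support[OF lat supp])
  have A\<Gamma>: "A *v i - j \<in> \<Gamma>" if "i \<in> \<Gamma>" "j \<in> \<Gamma>" for i j
    using that dil by (intro lattice_diff[OF lat]) (auto simp: dilation_matrix_def)
  have "finite {i\<in>\<Gamma>. c (A *v i - j) \<noteq> 0}" if "j \<in> J" for j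
    using dilation_matrix_invertible[OF dil] \<open>finite \<Lambda>\<close> c
    by (rule finite_column_support) (use that A\<Gamma> in \<open>auto simp: J_def\<close>)
  then have "finite I" unfolding I_def using \<open>finite J\<close> by blast
  have "I \<subseteq> \<Gamma>" by (auto simp: I_def)
  have \<phi>: "\<phi> (x + i) = (\<Sum>j\<in>J. c (A *v i - j) * \<phi> (A *v x + j))" if i: "i \<in> \<Gamma>" for i
  proof -
    have "\<phi> (x + i) = (\<Sum>k\<in>\<Lambda>. c k * \<phi> (A *v x + (A *v i - k)))"
      by (subst refine[rule_format]) (simp add: matrix_vector_right_distrib algebra_simps)
    also have "\<dots> = (\<Sum>j\<in>(\<lambda>k. A *v i - k) ` \<Lambda>. c (A *v i - j) * \<phi> (A *v x + j))"
      by (subst sum.reindex) (auto simp: inj_on_def)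
    \<comment> \<open>The index set depends on \<open>i\<close>; passing through the union with \<open>J\<close> replaces it by \<open>J\<close>,
      since the factor \<open>c\<close> vanishes on one difference and the factor \<open>\<phi>\<close> on the other.\<close>
    also have "\<dots> = (\<Sum>j\<in>J \<union> (\<lambda>k. A *v i - k) ` \<Lambda>. c (A *v i - j) * \<phi> (A *v x + j))"
    proof (rule sum.mono_neutral_left)
      show "\<forall>j\<in>J \<union> (\<lambda>k. A *v i - k) ` \<Lambda> - (\<lambda>k. A *v i - k) ` \<Lambda>.
          c (A *v i - j) * \<phi> (A *v x + j) = 0"
      proof
        fix j assume j: "j \<in> J \<union> (\<lambda>k. A *v i - k) ` \<Lambda> - (\<lambda>k. A *v i - k) ` \<Lambda>"
        then have "A *v i - j \<in> \<Gamma>" using A\<Gamma> i by (auto simp: J_def)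
        moreover have "A *v i - j \<notin> \<Lambda>"
          using j by (metis Diff_iff diff_diff_eq2 add_diff_cancel_left' image_eqI)
        ultimately show "c (A *v i - j) * \<phi> (A *v x + j) = 0" using c by simp
      qed
    qed (use \<open>finite J\<close> \<open>finite \<Lambda>\<close> in auto)
    also have "\<dots> = (\<Sum>j\<in>J. c (A *v i - j) * \<phi> (A *v x + j))"
      by (rule sum.mono_neutral_right)
        (use \<open>finite J\<close> \<open>finite \<Lambda>\<close> \<open>\<Lambda> \<subseteq> \<Gamma>\<close> A\<Gamma> i in \<open>auto simp: J_def\<close>)
    finally show ?thesis .
  qed
  have "combine \<Gamma> \<phi> (row_act A c \<Gamma> Y) (A *v x)
      = (\<Sum>j\<in>J. row_act A c \<Gamma> Y j * \<phi> (A *v x + j))"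
    unfolding combine_def by (rule infsum_finite_support) (use \<open>finite J\<close> in \<open>auto simp: J_def\<close>)
  also have "\<dots> = (\<Sum>j\<in>J. (\<Sum>i\<in>I. Y i * c (A *v i - j)) * \<phi> (A *v x + j))"
  proof (rule sum.cong[OF refl])
    fix j assume j: "j \<in> J"
    then have "row_act A c \<Gamma> Y j = (\<Sum>\<^sub>\<infinity>i\<in>\<Gamma>. Y i * c (A *v i - j))"
      by (simp add: row_act_def J_def)
    also have "\<dots> = (\<Sum>i\<in>I. Y i * c (A *v i - j))"
      by (rule infsum_finite_support) (use \<open>finite I\<close> \<open>I \<subseteq> \<Gamma>\<close> j in \<open>auto simp: I_def\<close>)
    finally show "row_act A c \<Gamma> Y j * \<phi> (A *v x + j)
        = (\<Sum>i\<in>I. Y i * c (A *v i - j)) * \<phi> (A *v x + j)" by simp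
  qed
  also have "\<dots> = (\<Sum>i\<in>I. Y i * (\<Sum>j\<in>J. c (A *v i - j) * \<phi> (A *v x + j)))"
    by (simp add: sum_distrib_left sum_distrib_right mult.assoc) (rule sum.swap)
  also have "\<dots> = (\<Sum>i\<in>I. Y i * \<phi> (x + i))"
    by (rule sum.cong) (use \<phi> \<open>I \<subseteq> \<Gamma>\<close> in auto)
  also have "\<dots> = combine \<Gamma> \<phi> Y x"
    unfolding combine_def
  proof (rule infsum_finite_support[symmetric, OF \<open>finite I\<close> \<open>I \<subseteq> \<Gamma>\<close>])
    fix i assume i: "i \<in> \<Gamma>" "i \<notin> I"
    then have "\<phi> (x + i) = 0" by (subst \<phi>) (auto simp: I_def intro!: sum.neutral)
    then show "Y i * \<phi> (x + i) = 0" by simp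
  qed
  finally show ?thesis .
qed

lemma combine_inverse_dilation:
  fixes A :: "real^'d^'d"
  assumes "is_lattice \<Gamma>" and dil: "dilation_matrix \<Gamma> A"
    and "\<Lambda> \<subseteq> \<Gamma>" and "finite \<Lambda>" and "\<forall>k\<in>\<Gamma> - \<Lambda>. c k = 0"
    and "compactly_supported \<phi>"
    and "\<forall>x. \<phi> x = (\<Sum>k\<in>\<Lambda>. c k * \<phi> (A *v x - k))"
  shows "combine \<Gamma> \<phi> Y (matrix_inv A *v x) = combine \<Gamma> \<phi> (row_act A c \<Gamma> Y) x"
  using combine_dilation[OF assms, of Y "matrix_inv A *v x"] dilation_matrix_invertible[OF dil]
  by (simp add: invertible_matrix_inv_vec)

section \<open>Powers of \<open>D\<^sub>A - \<lambda>\<close> and of \<open>L - \<lambda>\<close>\<close>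

text \<open>The binomial theorem for the operator \<open>h \<mapsto> h \<circ> g - \<lambda> h\<close>, a sum of two commuting
  operators. With \<open>g = A\<^sup>-\<^sup>1\<close> the right-hand side is the expression defining \<^const>\<open>H_class\<close>.\<close>

lemma funpow_compose_diff:
  fixes g :: "'a \<Rightarrow> 'a" and h :: "'a \<Rightarrow> complex"
  shows "((\<lambda>f x. f (g x) - lam * f x) ^^ r) h x
    = (\<Sum>k=0..r. of_nat (r choose k) * (- lam) ^ k * h ((g ^^ (r - k)) x))"
proof (induction r arbitrary: x)
  case 0
  then show ?case by simp
next
  case (Suc r)
  define b where "b k = h ((g ^^ (Suc r - k)) x)" for k
  define a where "a k = of_nat (r choose k) * (- lam) ^ k" for k
  have step: "((\<lambda>f x. f (g x) - lam * f x) ^^ Suc r) h x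
      = (\<Sum>k=0..r. a k * b k) + (\<Sum>k=0..r. - lam * a k * b (Suc k))"
  proof -
    have "h ((g ^^ (r - k)) (g x)) = b k" if "k \<le> r" for k
      using that by (simp add: b_def Suc_diff_le funpow_swap1)
    then show ?thesis
      by (simp add: Suc.IH a_def b_def sum_distrib_left sum_negf mult.assoc)
  qed
  have "(\<Sum>k=0..Suc r. of_nat (Suc r choose k) * (- lam) ^ k * b k)
      = b 0 + (\<Sum>k=0..r. of_nat (Suc r choose Suc k) * (- lam) ^ Suc k * b (Suc k))"
    by (simp add: sum.atLeast0_atMost_Suc_shift del: sum.cl_ivl_Suc binomial_Suc_Suc power_Suc)
  also have "\<dots> = b 0 + ((\<Sum>k=0..r. - lam * a k * b (Suc k)) + (\<Sum>k=0..r. a (Suc k) * b (Suc k)))"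
    by (simp add: a_def sum.distrib[symmetric] algebra_simps)
  also have "\<dots> = (\<Sum>k=0..Suc r. a k * b k) + (\<Sum>k=0..r. - lam * a k * b (Suc k))"
  proof -
    have "(\<Sum>k=0..Suc r. a k * b k) = b 0 + (\<Sum>k=0..r. a (Suc k) * b (Suc k))"
      by (simp add: sum.atLeast0_atMost_Suc_shift a_def del: sum.cl_ivl_Suc power_Suc)
    then show ?thesis by simp
  qed
  also have "(\<Sum>k=0..Suc r. a k * b k) = (\<Sum>k=0..r. a k * b k)"
    by (simp add: a_def)
  finally show ?case unfolding step by (simp add: b_def)
qed

lemma H_class_iff:
  "h \<in> H_class A lam r \<longleftrightarrow>
    (\<forall>x. ((\<lambda>f x. f (matrix_inv A *v x) - lam * f x) ^^ r) h x = 0)"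
  by (simp add: H_class_def funpow_compose_diff)

lemma funpow_combine:
  fixes A :: "real^'d^'d"
  assumes "is_lattice \<Gamma>" and "dilation_matrix \<Gamma> A"
    and "\<Lambda> \<subseteq> \<Gamma>" and "finite \<Lambda>" and "\<forall>k\<in>\<Gamma> - \<Lambda>. c k = 0"
    and "compactly_supported \<phi>"
    and "\<forall>x. \<phi> x = (\<Sum>k\<in>\<Lambda>. c k * \<phi> (A *v x - k))"
  shows "((\<lambda>f x. f (matrix_inv A *v x) - lam * f x) ^^ r) (combine \<Gamma> \<phi> Y)
    = combine \<Gamma> \<phi> (((\<lambda>Z j. row_act A c \<Gamma> Z j - lam * Z j) ^^ r) Y)"
  by (induction r)
    (simp_all add: fun_eq_iff combine_diff_scale[OF assms(1,6)] combine_inverse_dilation[OF assms])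

lemma funpow_row_act_in_seqs:
  assumes "Y \<in> seqs S"
  shows "((\<lambda>Z j. row_act A c S Z j - lam * Z j) ^^ r) Y \<in> seqs S"
  using assms by (induction r) (simp_all add: seqs_def row_act_def)

text \<open>Linear independence is phrased with the translates \<open>\<phi> (x - k)\<close>, whereas \<open>Y\<Phi>\<close> uses
  \<open>\<phi> (x + k)\<close>; reflecting the index set, which is symmetric, passes from one to the other.\<close>

lemma combine_eq_0_imp_eq_0:
  assumes "is_lattice \<Gamma>" "lin_indep_translates \<Gamma> \<phi>" "Y \<in> seqs \<Gamma>"
    and zero: "\<And>x. combine \<Gamma> \<phi> Y x = 0"
  shows "Y = (\<lambda>_. 0)"
proof -
  have neg_mem: "- k \<in> \<Gamma> \<longleftrightarrow> k \<in> \<Gamma>" for k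
    using lattice_uminus[OF assms(1)] by (metis minus_minus)
  have indep: "\<forall>x. (\<Sum>\<^sub>\<infinity>k\<in>\<Gamma>. \<alpha> k * \<phi> (x - k)) = 0 \<Longrightarrow> \<forall>k\<in>\<Gamma>. \<alpha> k = 0"
    if "\<alpha> \<in> seqs \<Gamma>" for \<alpha>
    using assms(2) that unfolding lin_indep_translates_def by blast
  have "\<forall>k\<in>\<Gamma>. Y (- k) = 0"
  proof (rule indep)
    show "(\<lambda>k. Y (- k)) \<in> seqs \<Gamma>" using assms(3) by (simp add: seqs_def neg_mem)
    show "\<forall>x. (\<Sum>\<^sub>\<infinity>k\<in>\<Gamma>. Y (- k) * \<phi> (x - k)) = 0"
    proof
      fix x
      have "(\<Sum>\<^sub>\<infinity>k\<in>\<Gamma>. Y (- k) * \<phi> (x - k)) = (\<Sum>\<^sub>\<infinity>k\<in>\<Gamma>. Y k * \<phi> (x + k))"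
        by (rule infsum_reindex_bij_witness[of _ uminus uminus]) (auto simp: neg_mem)
      then show "(\<Sum>\<^sub>\<infinity>k\<in>\<Gamma>. Y (- k) * \<phi> (x - k)) = 0"
        using zero by (simp add: combine_def)
    qed
  qed
  then have "Y k = 0" if "k \<in> \<Gamma>" for k
    using that neg_mem by (metis minus_minus)
  then show ?thesis using assms(3) by (auto simp: seqs_def)
qed

section \<open>Restriction to admissible sets\<close>

lemma restr_row_act:
  fixes A :: "real^'d^'d"
  assumes lat: "is_lattice \<Gamma>" and dil: "dilation_matrix \<Gamma> A"
    and c: "\<forall>k\<in>\<Gamma> - \<Lambda>. c k = 0" and adm: "admissible \<Gamma> A \<Lambda> S"
  shows "restr S (row_act A c \<Gamma> Y) = row_act A c S (restr S Y)"
proof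
  fix j
  show "restr S (row_act A c \<Gamma> Y) j = row_act A c S (restr S Y) j"
  proof (cases "j \<in> S")
    case True
    have "S \<subseteq> \<Gamma>" using adm by (simp add: admissible_def)
    have "c (A *v i - j) = 0" if i: "i \<in> \<Gamma>" "i \<notin> S" for i
    proof (rule ccontr)
      assume "c (A *v i - j) \<noteq> 0"
      moreover have "A *v i - j \<in> \<Gamma>"
        using i True \<open>S \<subseteq> \<Gamma>\<close> dil by (intro lattice_diff[OF lat]) (auto simp: dilation_matrix_def)
      ultimately have "A *v i - j \<in> \<Lambda>" using c by blast
      moreover have "i = matrix_inv A *v (j + (A *v i - j))"
        using dilation_matrix_invertible[OF dil]
        by (simp add: invertible_matrix_inv_vec)
      ultimately have "i \<in> w_map A \<Lambda> S" unfolding w_map_def using True by blast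
      then show False using adm i by (auto simp: admissible_def)
    qed
    then have "(\<Sum>\<^sub>\<infinity>i\<in>\<Gamma>. Y i * c (A *v i - j)) = (\<Sum>\<^sub>\<infinity>i\<in>S. restr S Y i * c (A *v i - j))"
      using \<open>S \<subseteq> \<Gamma>\<close> by (intro infsum_cong_neutral) (auto simp: restr_def)
    then show ?thesis using True \<open>S \<subseteq> \<Gamma>\<close> by (auto simp: restr_def row_act_def)
  qed (simp add: restr_def row_act_def)
qed

lemma restr_ker_pow:
  fixes A :: "real^'d^'d"
  assumes "is_lattice \<Gamma>" and "dilation_matrix \<Gamma> A"
    and "\<forall>k\<in>\<Gamma> - \<Lambda>. c k = 0" and "admissible \<Gamma> A \<Lambda> S"
    and "Y \<in> ker_pow A c \<Gamma> lam r"
  shows "restr S Y \<in> ker_pow A c S lam r"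
proof -
  have "((\<lambda>Z j. row_act A c S Z j - lam * Z j) ^^ m) (restr S Y)
      = restr S (((\<lambda>Z j. row_act A c \<Gamma> Z j - lam * Z j) ^^ m) Y)" for m
  proof (induction m)
    case (Suc m)
    then show ?case
      by (simp add: restr_row_act[OF assms(1-4), symmetric]) (simp add: restr_def fun_eq_iff)
  qed simp
  moreover have "((\<lambda>Z j. row_act A c \<Gamma> Z j - lam * Z j) ^^ r) Y = (\<lambda>_. 0)"
    using assms(5) by (simp add: ker_pow_def)
  ultimately show ?thesis by (simp add: ker_pow_def seqs_def restr_def fun_eq_iff)
qed

section \<open>Homogeneous functions and generalized eigenvectors\<close>

theorem proposition4p3:
  fixes \<Gamma> \<Lambda> D :: "(real^'d) set" and A :: "real^'d^'d"
    and c \<phi> :: "real^'d \<Rightarrow> complex" and \<Omega> :: "nat \<Rightarrow> (real^'d) set"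
    and lam :: complex and r n :: nat
  assumes "is_lattice \<Gamma>" and "dilation_matrix \<Gamma> A"
    and "\<Lambda> \<subseteq> \<Gamma>" and "finite \<Lambda>" and "\<Lambda> \<noteq> {}"
    and "\<forall>k\<in>\<Gamma> - \<Lambda>. c k = 0"
    and "compactly_supported \<phi>"
    and "\<forall>x. \<phi> x = (\<Sum>k\<in>\<Lambda>. c k * \<phi> (A *v x - k))"
    and "full_representatives \<Gamma> A D" and "0 \<in> D" and "tiles \<Gamma> (attractor A D)"
    and "admissible_chain \<Gamma> A \<Lambda> (diff_set \<Lambda> D) \<Omega>"
    and "lin_indep_translates \<Gamma> \<phi>"
    and "r \<ge> 1"
  shows "(\<forall>h\<in>translate_space \<Gamma> \<phi>. \<forall>Y\<in>seqs \<Gamma>.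
            h = combine \<Gamma> \<phi> Y \<and> h \<in> H_class A lam r \<longrightarrow>
              Y \<in> ker_pow A c \<Gamma> lam r \<and> restr (\<Omega> n) Y \<in> ker_pow A c (\<Omega> n) lam r)
       \<and> (lam \<noteq> 0 \<longrightarrow>
            (\<forall>v\<in>ker_pow A c (\<Omega> n) lam r. \<forall>Y\<^sub>v\<in>ker_pow A c \<Gamma> lam r.
              restr (\<Omega> n) Y\<^sub>v = v \<longrightarrow> combine \<Gamma> \<phi> Y\<^sub>v \<in> H_class A lam r))"
proof -
  note refinable = assms(1-4,6-8)
  have H_iff: "combine \<Gamma> \<phi> Y \<in> H_class A lam r \<longleftrightarrow>
      (\<forall>x. combine \<Gamma> \<phi> (((\<lambda>Z j. row_act A c \<Gamma> Z j - lam * Z j) ^^ r) Y) x = 0)" for Y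
    unfolding H_class_iff funpow_combine[OF refinable] ..
  have adm: "admissible \<Gamma> A \<Lambda> (\<Omega> n)"
    using assms(12) unfolding admissible_chain_def by blast
  have "Y \<in> ker_pow A c \<Gamma> lam r"
    if Y: "Y \<in> seqs \<Gamma>" "combine \<Gamma> \<phi> Y \<in> H_class A lam r" for Y
    using combine_eq_0_imp_eq_0[OF assms(1,13) funpow_row_act_in_seqs[OF Y(1)]] Y
    unfolding H_iff by (simp add: ker_pow_def)
  moreover have "combine \<Gamma> \<phi> Y \<in> H_class A lam r" if "Y \<in> ker_pow A c \<Gamma> lam r" for Y
    using that unfolding H_iff by (simp add: ker_pow_def combine_def)
  ultimately show ?thesis
    using restr_ker_pow[OF assms(1,2,6) adm] by blast
qed

end
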